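(* Let $p\in\mathbb N$ and let $(\mathbf A_n)_{n\in\mathbb N}$ be a sequence of finite $L$-structures. For each $n$ let $\mathbf B_n$ be the structure obtained from $\mathbf A_n$ by attaching $n$ new leaves to each vertex, all new leaves being marked by a distinct (new unary) symbol. Then $(\mathbf A_n)_n$ is $\mathrm{FO}_p$-convergent if and only if $(\mathbf B_n)_n$ is $\mathrm{FO}_p$-convergent.
   Context: $L$ is a purely relational first-order language with equality and finite positive arities. All structures are finite and nonempty. $\mathbf B_n$ is a structure in the language $L\cup\{E,M\}$, where $E$ is a binary symbol (new, or already in $L$) and $M\notin L$ is a new unary symbol: its universe is $V(\mathbf A_n)$ together with $n$ new vertices for each $v\in V(\mathbf A_n)$ (all distinct); each new vertex attached to $v$ is joined to $v$ by an undirected $E$-edge (both ordered pairs), $M$ holds exactly for the new vertices, and otherwise the relations are those of $\mathbf A_n$. $\mathrm{FO}_p$ is the set of first-order formulas (of the language in question) with free variables among $x_1,\dots,x_p$ (sentences are included, as formulas with dummy variables). $\langle\phi,\mathbf A\rangle$ is the probability that a uniformly random $p$-tuple of vertices of $\mathbf A$ satisfies $\phi$ ($1$ or $0$ according to truth for sentences). A sequence $(\mathbf A_n)_n$ is $\mathrm{FO}_p$-convergent if $\langle\phi,\mathbf A_n\rangle$ converges for each $\phi\in\mathrm{FO}_p$. *)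

theory Defs
  imports Complex_Main "HOL-Library.FuncSet"
begin

text \<open>A relational language is a set \<open>L\<close> of symbols, taken from an ambient type \<open>'r\<close>,
  together with an arity function on that type. The ambient type leaves room for symbols
  outside \<open>L\<close>, so that \<open>L\<close> can be extended.\<close>

record ('a, 'r) rel_struct =
  verts :: "'a set"
  interp :: "'r \<Rightarrow> 'a list set"

text \<open>The interpretation of symbols outside \<open>L\<close> is not constrained, and is never consulted.\<close>

definition finite_struct :: "'r set \<Rightarrow> ('r \<Rightarrow> nat) \<Rightarrow> ('a, 'r) rel_struct \<Rightarrow> bool" where
  "finite_struct L ar A \<longleftrightarrow>
     finite (verts A) \<and> verts A \<noteq> {} \<and>
     (\<forall>R\<in>L. interp A R \<subseteq> {vs. length vs = ar R \<and> set vs \<subseteq> verts A})"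

datatype 'r fm =
    Eq nat nat
  | Rel 'r "nat list"
  | Neg "'r fm"
  | Conj "'r fm" "'r fm"
  | Ex nat "'r fm"

primrec free_vars :: "'r fm \<Rightarrow> nat set" where
  "free_vars (Eq x y) = {x, y}"
| "free_vars (Rel R xs) = set xs"
| "free_vars (Neg \<phi>) = free_vars \<phi>"
| "free_vars (Conj \<phi> \<psi>) = free_vars \<phi> \<union> free_vars \<psi>"
| "free_vars (Ex x \<phi>) = free_vars \<phi> - {x}"

primrec formula_of :: "'r set \<Rightarrow> ('r \<Rightarrow> nat) \<Rightarrow> 'r fm \<Rightarrow> bool" where
  "formula_of L ar (Eq x y) \<longleftrightarrow> True"
| "formula_of L ar (Rel R xs) \<longleftrightarrow> R \<in> L \<and> length xs = ar R"
| "formula_of L ar (Neg \<phi>) \<longleftrightarrow> formula_of L ar \<phi>"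
| "formula_of L ar (Conj \<phi> \<psi>) \<longleftrightarrow> formula_of L ar \<phi> \<and> formula_of L ar \<psi>"
| "formula_of L ar (Ex x \<phi>) \<longleftrightarrow> formula_of L ar \<phi>"

primrec sat :: "('a, 'r) rel_struct \<Rightarrow> (nat \<Rightarrow> 'a) \<Rightarrow> 'r fm \<Rightarrow> bool" where
  "sat A e (Eq x y) \<longleftrightarrow> e x = e y"
| "sat A e (Rel R xs) \<longleftrightarrow> map e xs \<in> interp A R"
| "sat A e (Neg \<phi>) \<longleftrightarrow> \<not> sat A e \<phi>"
| "sat A e (Conj \<phi> \<psi>) \<longleftrightarrow> sat A e \<phi> \<and> sat A e \<psi>"
| "sat A e (Ex x \<phi>) \<longleftrightarrow> (\<exists>v\<in>verts A. sat A (e(x := v)) \<phi>)"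

definition FO :: "'r set \<Rightarrow> ('r \<Rightarrow> nat) \<Rightarrow> nat \<Rightarrow> 'r fm set" where
  "FO L ar p = {\<phi>. formula_of L ar \<phi> \<and> free_vars \<phi> \<subseteq> {1..p}}"

text \<open>A \<open>p\<close>-tuple of vertices is a function on \<open>{1..p}\<close>, used directly as the assignment of
  \<open>x\<^sub>1, \<dots>, x\<^sub>p\<close>. For \<open>p = 0\<close> there is exactly one (empty) tuple, so the pairing of a sentence
  is \<open>1\<close> or \<open>0\<close>.\<close>

definition pairing :: "nat \<Rightarrow> 'r fm \<Rightarrow> ('a, 'r) rel_struct \<Rightarrow> real" where
  "pairing p \<phi> A =
     real (card {t \<in> {1..p} \<rightarrow>\<^sub>E verts A. sat A t \<phi>}) / real (card ({1..p} \<rightarrow>\<^sub>E verts A))"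

definition FO_convergent ::
    "'r set \<Rightarrow> ('r \<Rightarrow> nat) \<Rightarrow> nat \<Rightarrow> (nat \<Rightarrow> ('a, 'r) rel_struct) \<Rightarrow> bool" where
  "FO_convergent L ar p A \<longleftrightarrow> (\<forall>\<phi>\<in>FO L ar p. convergent (\<lambda>n. pairing p \<phi> (A n)))"

text \<open>\<open>Inl v\<close> is the vertex \<open>v\<close> of the \<open>L\<close>-structure \<open>A\<close>, and \<open>Inr (v, i)\<close> with \<open>i < n\<close> are the
  leaves attached to \<open>v\<close>. If \<open>E \<in> L\<close>, the new edges are added to the \<open>E\<close>-relation of \<open>A\<close>;
  otherwise they are the only \<open>E\<close>-edges.\<close>

definition attach_leaves ::
    "'r set \<Rightarrow> 'r \<Rightarrow> 'r \<Rightarrow> nat \<Rightarrow> ('a, 'r) rel_struct \<Rightarrow> ('a + 'a \<times> nat, 'r) rel_struct" where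
  "attach_leaves L E M n A =
     \<lparr>verts = Inl ` verts A \<union> Inr ` (verts A \<times> {..<n}),
      interp = (\<lambda>R.
        (if R \<in> L then map Inl ` interp A R else {}) \<union>
        (if R = E then (\<Union>v\<in>verts A. \<Union>i<n. {[Inl v, Inr (v, i)], [Inr (v, i), Inl v]}) else {}) \<union>
        (if R = M then (\<Union>v\<in>verts A. \<Union>i<n. {[Inr (v, i)]}) else {}))\<rparr>"

lemma finite_struct_attach_leaves:
  assumes "finite_struct L ar A" and "ar E = 2" and "ar M = 1"
  shows "finite_struct (L \<union> {E, M}) ar (attach_leaves L E M n A)"
proof -
  let ?B = "attach_leaves L E M n A"
  have L: "length vs = ar R \<and> set vs \<subseteq> verts A" if "R \<in> L" "vs \<in> interp A R" for R vs
    using assms(1) that unfolding finite_struct_def by blast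
  have "length ws = ar R \<and> set ws \<subseteq> verts ?B" if ws: "ws \<in> interp ?B R" for R ws
  proof -
    from ws consider vs where "R \<in> L" "vs \<in> interp A R" "ws = map Inl vs"
      | v i where "R = E" "v \<in> verts A" "i < n" "ws = [Inl v, Inr (v, i)] \<or> ws = [Inr (v, i), Inl v]"
      | v i where "R = M" "v \<in> verts A" "i < n" "ws = [Inr (v, i)]"
      unfolding attach_leaves_def by (auto split: if_split_asm)
    then show ?thesis
    proof cases
      case 1
      then show ?thesis using L[of R vs] by (auto simp: attach_leaves_def)
    next
      case 2
      then show ?thesis using assms(2) by (elim disjE) (simp_all add: attach_leaves_def)
    next
      case 3
      then show ?thesis using assms(3) by (simp add: attach_leaves_def)
    qed
  qed
  moreover have "finite (verts ?B)" "verts ?B \<noteq> {}"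
    using assms(1) by (simp_all add: finite_struct_def attach_leaves_def)
  ultimately show ?thesis unfolding finite_struct_def by blast
qed

lemma sat_cong: "(\<And>x. x \<in> free_vars \<phi> \<Longrightarrow> e x = e' x) \<Longrightarrow> sat A e \<phi> \<longleftrightarrow> sat A e' \<phi>"
proof (induction \<phi> arbitrary: e e')
  case (Rel R xs)
  have "map e xs = map e' xs" by (rule map_cong[OF refl]) (use Rel.prems in simp)
  then show ?case by (simp only: sat.simps)
next
  case (Conj \<phi> \<psi>)
  have "sat A e \<phi> \<longleftrightarrow> sat A e' \<phi>" by (rule Conj.IH) (use Conj.prems in auto)
  moreover have "sat A e \<psi> \<longleftrightarrow> sat A e' \<psi>" by (rule Conj.IH) (use Conj.prems in auto)
  ultimately show ?case by simp
next
  case (Ex x \<phi>)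
  have "sat A (e(x := v)) \<phi> \<longleftrightarrow> sat A (e'(x := v)) \<phi>" for v
    by (rule Ex.IH) (use Ex.prems in auto)
  then show ?case by simp
next
  case (Neg \<phi>)
  have "sat A e \<phi> \<longleftrightarrow> sat A e' \<phi>" by (rule Neg.IH) (use Neg.prems in simp)
  then show ?case by simp
next
  case (Eq x y)
  have "e x = e' x" "e y = e' y" using Eq.prems by auto
  then show ?case by simp
qed

end

theory Submission
  imports Defs
begin

text \<open>A uniformly random tuple of the leafy structure is a uniformly random tuple of base vertices
  in \<open>A\<^sub>n\<close> together with independent uniform positions in \<open>{0..n}\<close>, where \<open>0\<close> is the base vertex itself.
  With probability tending to one, the positions are nonzero and pairwise distinct. For such positions,
  satisfaction of a formula depends only on the base vertices and is itself first-order over \<open>A\<^sub>n\<close>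
  once \<open>n\<close> is large: a quantified position only matters up to being zero, equal to the position of
  a free variable, or fresh. Conversely, a leaf defines its base vertex, so every formula about
  \<open>A\<^sub>n\<close> can be read off the bases of a tuple of leaves. In both directions the two pairings
  differ by at most the probability that the positions are not distinct and nonzero.\<close>

section \<open>Coordinates on the leafy structure: base vertex and position\<close>

text \<open>One number records both whether a vertex is a leaf and which leaf it is. An assignment
  into the leafy structure thus splits into two independent functions, one giving bases and one
  giving positions, and being a leaf becomes a test against \<open>0\<close>.\<close>

definition copy :: "'a \<Rightarrow> nat \<Rightarrow> 'a + 'a \<times> nat" where
  "copy v j = (case j of 0 \<Rightarrow> Inl v | Suc i \<Rightarrow> Inr (v, i))"

definition base :: "'a + 'a \<times> nat \<Rightarrow> 'a" where
  "base w = (case w of Inl v \<Rightarrow> v | Inr (v, i) \<Rightarrow> v)"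

lemma copy_0 [simp]: "copy v 0 = Inl v"
  and copy_Suc [simp]: "copy v (Suc i) = Inr (v, i)"
  by (simp_all add: copy_def)

lemma base_simps [simp]: "base (Inl v) = v" "base (Inr (v, i)) = v"
  by (simp_all add: base_def)

lemma base_copy [simp]: "base (copy v j) = v"
  by (cases j) auto

lemma copy_eq_iff [simp]: "copy v i = copy w j \<longleftrightarrow> v = w \<and> i = j"
  by (cases i; cases j) auto

lemma copy_eq_Inl_iff [simp]: "copy v j = Inl w \<longleftrightarrow> v = w \<and> j = 0"
  and Inl_eq_copy_iff [simp]: "Inl w = copy v j \<longleftrightarrow> v = w \<and> j = 0"
  by (cases j; auto)+

lemma copy_eq_Inr_iff [simp]: "copy v j = Inr (w, i) \<longleftrightarrow> v = w \<and> j = Suc i"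
  and Inr_eq_copy_iff [simp]: "Inr (w, i) = copy v j \<longleftrightarrow> v = w \<and> j = Suc i"
  by (cases j; auto)+

lemma verts_attach_leaves:
  "verts (attach_leaves L E M n A) = (\<lambda>(v, j). copy v j) ` (verts A \<times> {..n})" (is "_ = ?R")
proof
  show "verts (attach_leaves L E M n A) \<subseteq> ?R"
  proof
    fix w assume "w \<in> verts (attach_leaves L E M n A)"
    then consider v where "v \<in> verts A" "w = copy v 0"
      | v i where "v \<in> verts A" "i < n" "w = copy v (Suc i)"
      by (auto simp: attach_leaves_def)
    then show "w \<in> ?R" by cases (force simp: image_iff)+
  qed
  show "?R \<subseteq> verts (attach_leaves L E M n A)"
  proof clarify
    fix v j assume "v \<in> verts A" "j \<le> n"
    then show "copy v j \<in> verts (attach_leaves L E M n A)"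
      by (cases j) (auto simp: attach_leaves_def)
  qed
qed

lemma copy_in_verts_attach_leaves [simp]:
  "copy v j \<in> verts (attach_leaves L E M n A) \<longleftrightarrow> v \<in> verts A \<and> j \<le> n"
  by (auto simp: verts_attach_leaves)

lemma Inl_in_verts_attach_leaves [simp]:
  "Inl v \<in> verts (attach_leaves L E M n A) \<longleftrightarrow> v \<in> verts A"
  by (auto simp: attach_leaves_def)

lemma base_in_verts: "w \<in> verts (attach_leaves L E M n A) \<Longrightarrow> base w \<in> verts A"
  by (auto simp: verts_attach_leaves)

section \<open>Elimination of leaves: from formulas over the leafy structure to formulas over the
  base structure\<close>

lemma finite_free_vars [simp]: "finite (free_vars \<phi>)"
  by (induction \<phi>) auto

text \<open>A contradiction without free variables, so that a translation never acquires new ones.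
  It is refuted only over a nonempty universe, whence the nonemptiness conditions in the translation
  lemmas.\<close>

definition Falsum :: "'r fm" where "Falsum = Neg (Ex 0 (Eq 0 0))"

lemma Falsum_simps [simp]:
  "formula_of L ar Falsum" "free_vars Falsum = {}"
  "sat A e Falsum \<longleftrightarrow> verts A = {}"
  by (auto simp: Falsum_def)

text \<open>Serves the quantifier case, where the position of the quantified variable ranges over
  finitely many representatives. The disjunction is built up by De Morgan from
  \<open>Falsum\<close>.\<close>

lemma finite_disjunction:
  assumes "finite J" and "\<forall>j\<in>J. formula_of L ar (f j)"
  shows "\<exists>\<psi>. formula_of L ar \<psi> \<and>
    free_vars \<psi> \<subseteq> (\<Union>j\<in>J. free_vars (f j)) \<and>
    (\<forall>(A :: ('a, 'r) rel_struct) e. verts A \<noteq> {} \<longrightarrow> sat A e \<psi> = (\<exists>j\<in>J. sat A e (f j)))"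
  using assms
proof induction
  case empty
  show ?case by (rule exI[of _ Falsum]) auto
next
  case (insert j J)
  from insert.prems have "\<forall>j\<in>J. formula_of L ar (f j)" by simp
  from insert.IH[OF this] obtain \<psi> where \<psi>: "formula_of L ar \<psi>"
    "free_vars \<psi> \<subseteq> (\<Union>j\<in>J. free_vars (f j))"
    "\<And>(A :: ('a, 'r) rel_struct) e. verts A \<noteq> {} \<Longrightarrow> sat A e \<psi> = (\<exists>j\<in>J. sat A e (f j))"
    by blast
  show ?case
    by (rule exI[of _ "Neg (Conj (Neg (f j)) (Neg \<psi>))"])
      (use \<psi> insert.prems in auto)
qed

text \<open>The vertex assigned to a variable \<open>x\<close> of the leafy structure is \<open>copy (r x) (k x)\<close>. Only
  the pattern of \<open>k\<close> matters to a formula: whether \<open>k x = 0\<close>, and whether \<open>k x = k y\<close>.\<close>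

definition same_pattern :: "nat set \<Rightarrow> (nat \<Rightarrow> nat) \<Rightarrow> (nat \<Rightarrow> nat) \<Rightarrow> bool" where
  "same_pattern X k k' \<longleftrightarrow> (\<forall>x\<in>X. k x = 0 \<longleftrightarrow> k' x = 0) \<and> (\<forall>x\<in>X. \<forall>y\<in>X. k x = k y \<longleftrightarrow> k' x = k' y)"

lemma same_pattern_mono: "same_pattern Y k k' \<Longrightarrow> X \<subseteq> Y \<Longrightarrow> same_pattern X k k'"
  unfolding same_pattern_def by blast

text \<open>Here \<open>k\<close> only names a pattern and need not be bounded by \<open>n\<close>;
  the actual positions are \<open>k'\<close>. Asking for all \<open>k'\<close> of that pattern lets
  one translation serve every \<open>n\<close>, although the positions that realise the pattern
  change.\<close>

definition expressed_by ::
    "'r set \<Rightarrow> 'r \<Rightarrow> 'r \<Rightarrow> nat \<Rightarrow> ('a, 'r) rel_struct \<Rightarrow> (nat \<Rightarrow> nat) \<Rightarrow> 'r fm \<Rightarrow> 'r fm \<Rightarrow> bool" where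
  "expressed_by L E M n A k \<phi> \<psi> \<longleftrightarrow> (\<forall>r k'. r ` free_vars \<phi> \<subseteq> verts A \<longrightarrow>
     k' ` free_vars \<phi> \<subseteq> {..n} \<longrightarrow> same_pattern (free_vars \<phi>) k k' \<longrightarrow>
     sat (attach_leaves L E M n A) (\<lambda>x. copy (r x) (k' x)) \<phi> = sat A r \<psi>)"

lemma expressed_byD:
  assumes "expressed_by L E M n A k \<phi> \<psi>" and "r ` free_vars \<phi> \<subseteq> verts A"
    and "k' ` free_vars \<phi> \<subseteq> {..n}" and "same_pattern (free_vars \<phi>) k k'"
  shows "sat (attach_leaves L E M n A) (\<lambda>x. copy (r x) (k' x)) \<phi> = sat A r \<psi>"
  using assms unfolding expressed_by_def by blast

text \<open>The set \<open>J\<close> holds one representative for each way in which a new position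
  can relate to the old ones, with \<open>j0\<close> standing for every fresh leaf position. The
  bound on \<open>n\<close> guarantees that a fresh leaf position really exists below the chosen
  vertex.\<close>

lemma expressed_by_Ex:
  assumes j0: "j0 \<notin> insert 0 (k ` (free_vars \<phi> - {x}))"
    and J: "J = insert 0 (insert j0 (k ` (free_vars \<phi> - {x})))"
    and n: "card (free_vars \<phi>) < n"
    and f: "\<And>j. j \<in> J \<Longrightarrow> expressed_by L E M n A (k(x := j)) \<phi> (f j)"
    and \<psi>: "\<And>e. sat A e \<psi> = (\<exists>j\<in>J. sat A e (f j))"
  shows "expressed_by L E M n A k (Ex x \<phi>) (Ex x \<psi>)"
  unfolding expressed_by_def
proof (intro allI impI)
  let ?B = "attach_leaves L E M n A" and ?X = "free_vars \<phi> - {x}"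
  fix r k' assume r: "r ` free_vars (Ex x \<phi>) \<subseteq> verts A"
    and k': "k' ` free_vars (Ex x \<phi>) \<subseteq> {..n}"
    and pat: "same_pattern (free_vars (Ex x \<phi>)) k k'"
  have pat0: "k y = 0 \<longleftrightarrow> k' y = 0" if "y \<in> ?X" for y
    using pat that unfolding same_pattern_def by simp
  have pateq: "k y = k z \<longleftrightarrow> k' y = k' z" if "y \<in> ?X" "z \<in> ?X" for y z
    using pat that unfolding same_pattern_def by simp
  \<comment> \<open>If \<open>j'\<close> relates to the actual positions as \<open>j\<close> relates
    to the named ones, then the two updated position functions again have the same pattern, so the
    hypothesis for \<open>j\<close> applies.\<close>
  have upd: "sat ?B ((\<lambda>y. copy (r y) (k' y))(x := copy v j')) \<phi> = sat A (r(x := v)) (f j)"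
    if v: "v \<in> verts A" and j: "j \<in> J" and j': "j' \<le> n" and z: "j = 0 \<longleftrightarrow> j' = 0"
      and eq: "\<And>y. y \<in> ?X \<Longrightarrow> k y = j \<longleftrightarrow> k' y = j'" for v j j'
  proof -
    have "(\<lambda>y. copy (r y) (k' y))(x := copy v j') = (\<lambda>y. copy ((r(x := v)) y) ((k'(x := j')) y))"
      by auto
    moreover have "same_pattern (free_vars \<phi>) (k(x := j)) (k'(x := j'))"
      unfolding same_pattern_def
    proof (intro conjI ballI)
      fix y assume y: "y \<in> free_vars \<phi>"
      show "(k(x := j)) y = 0 \<longleftrightarrow> (k'(x := j')) y = 0"
        using pat0[of y] y z by auto
      fix w assume w: "w \<in> free_vars \<phi>"
      show "(k(x := j)) y = (k(x := j)) w \<longleftrightarrow> (k'(x := j')) y = (k'(x := j')) w"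
        using pateq[of y w] eq[of y] eq[of w] y w by (cases "y = x"; cases "w = x") auto
    qed
    moreover have "(r(x := v)) ` free_vars \<phi> \<subseteq> verts A" "(k'(x := j')) ` free_vars \<phi> \<subseteq> {..n}"
      using r k' v j' by auto
    ultimately show ?thesis
      using expressed_byD[OF f[OF j], of "r(x := v)" "k'(x := j')"] by simp
  qed
  have j0_new: "j0 \<noteq> 0" "j0 \<notin> k ` ?X" "j0 \<in> J" using j0 J by simp_all
  \<comment> \<open>The free variables other than \<open>x\<close> occupy fewer than
    \<open>n\<close> positions, so one of the \<open>n\<close> leaf positions stays unoccupied; it
    will realise \<open>j0\<close>.\<close>
  have "card (k' ` ?X) < card {1..n}"
    using n card_image_le[of ?X k'] card_Diff1_le[of "free_vars \<phi>" x] by simp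
  then have "\<not> {1..n} \<subseteq> k' ` ?X"
    using card_mono[of "k' ` ?X" "{1..n}"] by auto
  then obtain i0 where i0: "i0 \<in> {1..n}" "i0 \<notin> k' ` ?X" by blast
  show "sat ?B (\<lambda>y. copy (r y) (k' y)) (Ex x \<phi>) = sat A r (Ex x \<psi>)"
  proof
    assume "sat ?B (\<lambda>y. copy (r y) (k' y)) (Ex x \<phi>)"
    then obtain v j' where v: "v \<in> verts A" and j': "j' \<le> n"
      and s: "sat ?B ((\<lambda>y. copy (r y) (k' y))(x := copy v j')) \<phi>"
      by (auto simp: verts_attach_leaves)
    \<comment> \<open>From an actual position to its representative: \<open>0\<close> for a base
      vertex, \<open>k y\<close> if the position is shared with some \<open>y\<close>, and
      \<open>j0\<close> otherwise.\<close>
    have "\<exists>j\<in>J. (j = 0 \<longleftrightarrow> j' = 0) \<and> (\<forall>y\<in>?X. k y = j \<longleftrightarrow> k' y = j')"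
    proof (cases "j' = 0")
      case True
      then show ?thesis using pat0 J by auto
    next
      case nz: False
      show ?thesis
      proof (cases "j' \<in> k' ` ?X")
        case True
        then obtain y where y: "y \<in> ?X" "j' = k' y" by blast
        have "k y \<in> J" using J y(1) by blast
        moreover have "(k y = 0 \<longleftrightarrow> j' = 0) \<and> (\<forall>z\<in>?X. k z = k y \<longleftrightarrow> k' z = j')"
          using y pat0[of y] pateq[of _ y] by simp
        ultimately show ?thesis by (rule bexI[rotated])
      next
        case False
        have "k y \<noteq> j0 \<and> k' y \<noteq> j'" if "y \<in> ?X" for y
          using imageI[OF that, of k] imageI[OF that, of k'] j0_new False by metis
        then show ?thesis using nz j0_new by (intro bexI[of _ j0]) simp_all
      qed
    qed
    then obtain j where j: "j \<in> J" "j = 0 \<longleftrightarrow> j' = 0"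
      "\<And>y. y \<in> ?X \<Longrightarrow> k y = j \<longleftrightarrow> k' y = j'"
      by blast
    have "sat A (r(x := v)) (f j)" using upd[OF v j(1) j' j(2,3)] s by simp
    then have "sat A (r(x := v)) \<psi>" using j(1) \<psi> by blast
    then show "sat A r (Ex x \<psi>)" using v by auto
  next
    assume "sat A r (Ex x \<psi>)"
    then obtain v where v: "v \<in> verts A" and "sat A (r(x := v)) \<psi>" by auto
    then obtain j where j: "j \<in> J" and s: "sat A (r(x := v)) (f j)" using \<psi> by blast
    \<comment> \<open>Conversely each representative is realised within \<open>{..n}\<close>:
      \<open>0\<close> by itself, \<open>j0\<close> by the unoccupied \<open>i0\<close>, and
      \<open>k y\<close> by \<open>k' y\<close>.\<close>
    have "\<exists>j'\<le>n. (j = 0 \<longleftrightarrow> j' = 0) \<and> (\<forall>y\<in>?X. k y = j \<longleftrightarrow> k' y = j')"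
    proof -
      consider "j = 0" | "j = j0" | y where "y \<in> ?X" "j = k y" using j J by blast
      then show ?thesis
      proof cases
        case 1
        then show ?thesis using pat0 by auto
      next
        case 2
        then have "i0 \<le> n \<and> (j = 0 \<longleftrightarrow> i0 = 0) \<and> (\<forall>y\<in>?X. k y = j \<longleftrightarrow> k' y = i0)"
          using i0 j0_new by auto
        then show ?thesis by (rule exI)
      next
        case (3 y)
        then have "k' y \<le> n" using k' by auto
        moreover have "(j = 0 \<longleftrightarrow> k' y = 0) \<and> (\<forall>z\<in>?X. k z = j \<longleftrightarrow> k' z = k' y)"
          using 3 pat0[of y] pateq[of _ y] by simp
        ultimately show ?thesis by (intro exI[of _ "k' y"] conjI) simp_all
      qed
    qed
    then obtain j' where j': "j' \<le> n" "j = 0 \<longleftrightarrow> j' = 0"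
      "\<And>y. y \<in> ?X \<Longrightarrow> k y = j \<longleftrightarrow> k' y = j'" by blast
    from upd[OF v j j'] s have "sat ?B ((\<lambda>y. copy (r y) (k' y))(x := copy v j')) \<phi>" by simp
    moreover have "copy v j' \<in> verts ?B" using v j' by simp
    ultimately show "sat ?B (\<lambda>y. copy (r y) (k' y)) (Ex x \<phi>)" by auto
  qed
qed

text \<open>Positions enter only through tests for zero, which is why the pattern settles their
  contribution to a relational atom. The exclusive or covers both orientations of a leaf
  edge.\<close>

lemma interp_attach_leaves:
  assumes "ar E = 2" "ar M = 1" "M \<notin> L" "\<forall>x\<in>set xs. r x \<in> verts A \<and> k x \<le> n"
  shows "map (\<lambda>x. copy (r x) (k x)) xs \<in> interp (attach_leaves L E M n A) R \<longleftrightarrow>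
    (R \<in> L \<and> (\<forall>x\<in>set xs. k x = 0) \<and> map r xs \<in> interp A R) \<or>
    (R = E \<and> (\<exists>x y. xs = [x, y] \<and> r x = r y \<and> (k x = 0) \<noteq> (k y = 0))) \<or>
    (R = M \<and> (\<exists>x. xs = [x] \<and> k x \<noteq> 0))"
    (is "?w \<in> _ \<longleftrightarrow> ?P \<or> ?Q \<or> ?S")
proof -
  have 1: "?w \<in> map Inl ` X \<longleftrightarrow> (\<forall>x\<in>set xs. k x = 0) \<and> map r xs \<in> X" for X
  proof
    assume "?w \<in> map Inl ` X"
    then obtain vs where vs: "vs \<in> X" "?w = map Inl vs" by blast
    then have "length xs = length vs" using map_eq_imp_length_eq by blast
    then have "(\<forall>x\<in>set xs. k x = 0) \<and> map r xs = vs" using vs(2)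
      by (induction xs vs rule: list_induct2) auto
    then show "(\<forall>x\<in>set xs. k x = 0) \<and> map r xs \<in> X" using vs by blast
  next
    assume a: "(\<forall>x\<in>set xs. k x = 0) \<and> map r xs \<in> X"
    then have "?w = map Inl (map r xs)" by simp
    then show "?w \<in> map Inl ` X" using a by blast
  qed
  have 2: "?w \<in> (\<Union>v\<in>verts A. \<Union>i<n. {[Inl v, Inr (v, i)], [Inr (v, i), Inl v]}) \<longleftrightarrow>
     (\<exists>x y. xs = [x, y] \<and> r x = r y \<and> (k x = 0) \<noteq> (k y = 0))" (is "?l \<longleftrightarrow> ?r")
  proof
    assume ?l
    then show ?r by (auto simp: map_eq_Cons_conv)
  next
    assume ?r
    then obtain x y where xy: "xs = [x, y]" "r x = r y" "(k x = 0) \<noteq> (k y = 0)" by blast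
    \<comment> \<open>One of the two positions is \<open>0\<close>, so the sum is the other one; the
      leaf at position \<open>Suc i\<close> has index \<open>i\<close>.\<close>
    define i where "i = k x + k y - 1"
    have "i < n" "(k x = 0 \<and> k y = Suc i) \<or> (k y = 0 \<and> k x = Suc i)"
      using xy assms(4) by (auto simp: i_def)
    then show ?l using xy assms(4) by auto
  qed
  have 3: "?w \<in> (\<Union>v\<in>verts A. \<Union>i<n. {[Inr (v, i)]}) \<longleftrightarrow> (\<exists>x. xs = [x] \<and> k x \<noteq> 0)" (is "?l \<longleftrightarrow> ?r")
  proof
    assume ?l
    then show ?r by (auto simp: map_eq_Cons_conv)
  next
    assume ?r
    then obtain x i where x: "xs = [x]" "k x = Suc i" using not0_implies_Suc by blast
    then have "i < n" using assms(4) by auto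
    then show ?l using x assms(4) by auto
  qed
  show ?thesis using 1 2 3 unfolding attach_leaves_def by simp
qed

text \<open>Each pattern gets its own translation, so \<open>k\<close> must vary in the induction: a
  quantifier over leafy vertices becomes a quantifier over bases followed by a disjunction over
  extended patterns. The threshold \<open>N\<close> provides fresh leaves for the quantifiers and
  depends on the formula and the pattern, not on the structure.\<close>

lemma leaf_elimination:
  fixes L :: "'r set"
  assumes ar: "ar E = 2" "ar M = 1" and M_new: "M \<notin> L"
  shows "formula_of (L \<union> {E, M}) ar \<phi> \<Longrightarrow> \<exists>\<psi> N. formula_of L ar \<psi> \<and> free_vars \<psi> \<subseteq> free_vars \<phi> \<and>
    (\<forall>n\<ge>N. \<forall>A :: ('a, 'r) rel_struct. verts A \<noteq> {} \<longrightarrow> expressed_by L E M n A k \<phi> \<psi>)"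
proof (induction \<phi> arbitrary: k)
  case (Eq x y)
  let ?\<psi> = "if k x = k y then Eq x y else Falsum"
  have ex: "expressed_by L E M n A k (Eq x y) ?\<psi>" if "verts A \<noteq> {}"
    for n and A :: "('a, 'r) rel_struct"
    unfolding expressed_by_def
  proof (intro allI impI)
    fix r k' assume "same_pattern (free_vars (Eq x y :: 'r fm)) k k'"
    then have "k x = k y \<longleftrightarrow> k' x = k' y" by (simp add: same_pattern_def)
    then show "sat (attach_leaves L E M n A) (\<lambda>x. copy (r x) (k' x)) (Eq x y) = sat A r ?\<psi>"
      using that by (cases "k' x = k' y") simp_all
  qed
  show ?case
    by (rule exI[of _ ?\<psi>], rule exI[of _ 0], intro conjI allI impI ex) auto
next
  case (Rel R xs)
  \<comment> \<open>At most one branch can apply. A leaf edge has a nonzero position, so it never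
    competes with an old tuple even if \<open>E\<close> lies in \<open>L\<close>; and
    \<open>M\<close> is outside \<open>L\<close> and differs from \<open>E\<close> by arity. For a
    leaf edge only equality of the two bases remains to be asserted, while a mark is settled by
    positions alone.\<close>
  let ?\<psi> = "if R \<in> L \<and> (\<forall>x\<in>set xs. k x = 0) then Rel R xs
    else if R = E \<and> (\<exists>x y. xs = [x, y] \<and> (k x = 0) \<noteq> (k y = 0)) then Eq (xs ! 0) (xs ! 1)
    else if R = M \<and> (\<exists>x. xs = [x] \<and> k x \<noteq> 0) then Neg Falsum else Falsum"
  have "R \<noteq> M \<or> R \<noteq> E" using ar by auto
  have ex: "expressed_by L E M n A k (Rel R xs) ?\<psi>" if "verts A \<noteq> {}"
    for n and A :: "('a, 'r) rel_struct"
    unfolding expressed_by_def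
  proof (intro allI impI)
    fix r k' assume *: "r ` free_vars (Rel R xs) \<subseteq> verts A" "k' ` free_vars (Rel R xs) \<subseteq> {..n}"
      "same_pattern (free_vars (Rel R xs)) k k'"
    have k: "k' x = 0 \<longleftrightarrow> k x = 0" if "x \<in> set xs" for x
      using *(3) that by (simp add: same_pattern_def)
    have k0: "(\<forall>x\<in>set xs. k' x = 0) \<longleftrightarrow> (\<forall>x\<in>set xs. k x = 0)" using k by simp
    have k1: "xs = [x] \<and> k' x \<noteq> 0 \<longleftrightarrow> xs = [x] \<and> k x \<noteq> 0" for x
      using k[of x] by (cases "xs = [x]") simp_all
    have k2: "xs = [x, y] \<and> r x = r y \<and> (k' x = 0) \<noteq> (k' y = 0) \<longleftrightarrow>
        xs = [x, y] \<and> r x = r y \<and> (k x = 0) \<noteq> (k y = 0)" for x y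
      using k[of x] k[of y] by (cases "xs = [x, y]") simp_all
    have "sat (attach_leaves L E M n A) (\<lambda>x. copy (r x) (k' x)) (Rel R xs) \<longleftrightarrow>
      (R \<in> L \<and> (\<forall>x\<in>set xs. k' x = 0) \<and> map r xs \<in> interp A R) \<or>
      (R = E \<and> (\<exists>x y. xs = [x, y] \<and> r x = r y \<and> (k' x = 0) \<noteq> (k' y = 0))) \<or>
      (R = M \<and> (\<exists>x. xs = [x] \<and> k' x \<noteq> 0))"
      unfolding sat.simps by (rule interp_attach_leaves[OF ar M_new]) (use * in auto)
    also have "\<dots> \<longleftrightarrow> (R \<in> L \<and> (\<forall>x\<in>set xs. k x = 0) \<and> map r xs \<in> interp A R) \<or>
      (R = E \<and> (\<exists>x y. xs = [x, y] \<and> r x = r y \<and> (k x = 0) \<noteq> (k y = 0))) \<or>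
      (R = M \<and> (\<exists>x. xs = [x] \<and> k x \<noteq> 0))"
      by (simp only: k0 k1 k2)
    also have "\<dots> \<longleftrightarrow> sat A r ?\<psi>"
      using that M_new \<open>R \<noteq> M \<or> R \<noteq> E\<close> by auto
    finally show "sat (attach_leaves L E M n A) (\<lambda>x. copy (r x) (k' x)) (Rel R xs) = sat A r ?\<psi>" .
  qed
  show ?case
    by (rule exI[of _ ?\<psi>], rule exI[of _ 0], intro conjI allI impI ex) (use Rel.prems in auto)
next
  case (Neg \<phi>)
  then have "formula_of (L \<union> {E, M}) ar \<phi>" by simp
  from Neg.IH[OF this, of k]
  obtain \<psi> N where \<psi>: "formula_of L ar \<psi>" "free_vars \<psi> \<subseteq> free_vars \<phi>"
    "\<And>n (A :: ('a, 'r) rel_struct). n \<ge> N \<Longrightarrow> verts A \<noteq> {} \<Longrightarrow> expressed_by L E M n A k \<phi> \<psi>"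
    by blast
  have "expressed_by L E M n A k (Neg \<phi>) (Neg \<psi>)"
    if "n \<ge> N" "verts A \<noteq> {}" for n and A :: "('a, 'r) rel_struct"
    unfolding expressed_by_def sat.simps free_vars.simps
    by (intro allI impI arg_cong[where f = Not] expressed_byD[OF \<psi>(3)[OF that]])
  then show ?case
    by (intro exI[of _ "Neg \<psi>"] exI[of _ N]) (use \<psi>(1,2) in auto)
next
  case (Conj \<phi>1 \<phi>2)
  have "formula_of (L \<union> {E, M}) ar \<phi>1" "formula_of (L \<union> {E, M}) ar \<phi>2" using Conj.prems by auto
  from Conj.IH(1)[OF this(1), of k] Conj.IH(2)[OF this(2), of k]
  obtain \<psi>1 N1 \<psi>2 N2 where \<psi>1: "formula_of L ar \<psi>1" "free_vars \<psi>1 \<subseteq> free_vars \<phi>1"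
    "\<And>n (A :: ('a, 'r) rel_struct). n \<ge> N1 \<Longrightarrow> verts A \<noteq> {} \<Longrightarrow> expressed_by L E M n A k \<phi>1 \<psi>1"
    and \<psi>2: "formula_of L ar \<psi>2" "free_vars \<psi>2 \<subseteq> free_vars \<phi>2"
    "\<And>n (A :: ('a, 'r) rel_struct). n \<ge> N2 \<Longrightarrow> verts A \<noteq> {} \<Longrightarrow> expressed_by L E M n A k \<phi>2 \<psi>2"
    by metis
  have "expressed_by L E M n A k (Conj \<phi>1 \<phi>2) (Conj \<psi>1 \<psi>2)"
    if "n \<ge> max N1 N2" "verts A \<noteq> {}" for n and A :: "('a, 'r) rel_struct"
    unfolding expressed_by_def
  proof (intro allI impI)
    fix r k' assume *: "r ` free_vars (Conj \<phi>1 \<phi>2) \<subseteq> verts A" "k' ` free_vars (Conj \<phi>1 \<phi>2) \<subseteq> {..n}"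
      "same_pattern (free_vars (Conj \<phi>1 \<phi>2)) k k'"
    have "sat (attach_leaves L E M n A) (\<lambda>x. copy (r x) (k' x)) \<phi>1 = sat A r \<psi>1"
      by (rule expressed_byD[OF \<psi>1(3)]) (use * that in \<open>auto intro: same_pattern_mono\<close>)
    moreover have "sat (attach_leaves L E M n A) (\<lambda>x. copy (r x) (k' x)) \<phi>2 = sat A r \<psi>2"
      by (rule expressed_byD[OF \<psi>2(3)]) (use * that in \<open>auto intro: same_pattern_mono\<close>)
    ultimately show "sat (attach_leaves L E M n A) (\<lambda>x. copy (r x) (k' x)) (Conj \<phi>1 \<phi>2) =
      sat A r (Conj \<psi>1 \<psi>2)" by simp
  qed
  then show ?case
    by (intro exI[of _ "Conj \<psi>1 \<psi>2"] exI[of _ "max N1 N2"]) (use \<psi>1(1,2) \<psi>2(1,2) in auto)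
next
  case (Ex x \<phi>)
  have "formula_of (L \<union> {E, M}) ar \<phi>" using Ex.prems by simp
  then have "\<forall>j. \<exists>\<psi> N. formula_of L ar \<psi> \<and> free_vars \<psi> \<subseteq> free_vars \<phi> \<and>
    (\<forall>n\<ge>N. \<forall>A :: ('a, 'r) rel_struct. verts A \<noteq> {} \<longrightarrow> expressed_by L E M n A (k(x := j)) \<phi> \<psi>)"
    using Ex.IH by blast
  then obtain f g where f: "\<And>j. formula_of L ar (f j)" "\<And>j. free_vars (f j) \<subseteq> free_vars \<phi>"
    "\<And>j n (A :: ('a, 'r) rel_struct). n \<ge> g j \<Longrightarrow> verts A \<noteq> {} \<Longrightarrow>
      expressed_by L E M n A (k(x := j)) \<phi> (f j)"
    by metis
  obtain j0 where j0: "j0 \<notin> insert 0 (k ` (free_vars \<phi> - {x}))"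
    using ex_new_if_finite[of "insert 0 (k ` (free_vars \<phi> - {x}))"] by auto
  define J where "J = insert 0 (insert j0 (k ` (free_vars \<phi> - {x})))"
  have "finite J" by (simp add: J_def)
  moreover have "\<forall>j\<in>J. formula_of L ar (f j)" using f(1) by simp
  ultimately have "\<exists>\<psi>. formula_of L ar \<psi> \<and> free_vars \<psi> \<subseteq> (\<Union>j\<in>J. free_vars (f j)) \<and>
    (\<forall>(A :: ('a, 'r) rel_struct) e. verts A \<noteq> {} \<longrightarrow> sat A e \<psi> = (\<exists>j\<in>J. sat A e (f j)))"
    by (rule finite_disjunction)
  then obtain \<psi> where \<psi>: "formula_of L ar \<psi>" "free_vars \<psi> \<subseteq> (\<Union>j\<in>J. free_vars (f j))"
    "\<forall>(A :: ('a, 'r) rel_struct) e. verts A \<noteq> {} \<longrightarrow> sat A e \<psi> = (\<exists>j\<in>J. sat A e (f j))"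
    by (elim exE conjE) (rule that)
  \<comment> \<open>The first summand makes room for a fresh leaf; the sum dominates the thresholds
    of all the disjuncts.\<close>
  define N where "N = Suc (card (free_vars \<phi>)) + (\<Sum>j\<in>J. g j)"
  have gN: "g j \<le> N" if "j \<in> J" for j
    using member_le_sum[OF that, of g] \<open>finite J\<close> by (simp add: N_def)
  have "expressed_by L E M n A k (Ex x \<phi>) (Ex x \<psi>)"
    if "n \<ge> N" "verts A \<noteq> {}" for n and A :: "('a, 'r) rel_struct"
  proof (rule expressed_by_Ex[OF j0 J_def])
    show "card (free_vars \<phi>) < n" using that by (simp add: N_def)
    show "expressed_by L E M n A (k(x := j)) \<phi> (f j)" if "j \<in> J" for j
      using f(3) gN[OF that] \<open>n \<ge> N\<close> \<open>verts A \<noteq> {}\<close> by force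
    show "sat A e \<psi> = (\<exists>j\<in>J. sat A e (f j))" for e using \<psi>(3) that by blast
  qed
  moreover have "free_vars \<psi> \<subseteq> free_vars \<phi>" using \<psi>(2) f(2) by blast
  ultimately show ?case
    by (intro exI[of _ "Ex x \<psi>"] exI[of _ N]) (use \<psi>(1) in auto)
qed

section \<open>Interpretation of the base structure in the leafy one\<close>

text \<open>The nested negations encode a disjunction: \<open>z\<close> is unmarked and is either
  \<open>x\<close> itself or a neighbour of the marked \<open>x\<close>. The mark on
  \<open>x\<close> rules out edges of the original structure when \<open>E\<close> lies in
  \<open>L\<close>; the only neighbour of a leaf is its base.\<close>

definition Base :: "'r \<Rightarrow> 'r \<Rightarrow> nat \<Rightarrow> nat \<Rightarrow> 'r fm" where
  "Base E M x z = Conj (Neg (Rel M [z]))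
     (Neg (Conj (Neg (Eq x z)) (Neg (Conj (Rel M [x]) (Rel E [x, z])))))"

lemma Base_syntax [simp]:
  "free_vars (Base E M x z) = {x, z}"
  "E \<in> L \<Longrightarrow> M \<in> L \<Longrightarrow> ar E = 2 \<Longrightarrow> ar M = 1 \<Longrightarrow> formula_of L ar (Base E M x z)"
  by (auto simp: Base_def)

lemma sat_Base:
  fixes ar :: "'r \<Rightarrow> nat"
  assumes "ar E = 2" "ar M = 1" "M \<notin> L"
    and "e x \<in> verts (attach_leaves L E M n A)" "e z \<in> verts (attach_leaves L E M n A)"
  shows "sat (attach_leaves L E M n A) e (Base E M x z) \<longleftrightarrow> e z = Inl (base (e x))"
proof -
  have "M \<noteq> E" using assms by auto
  show ?thesis using assms \<open>M \<noteq> E\<close>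
    by (auto simp: Base_def attach_leaves_def)
qed

definition bases :: "(nat \<Rightarrow> 'a + 'a \<times> nat) \<Rightarrow> nat \<Rightarrow> 'a" where
  "bases e x = base (e x)"

lemma bases_fun_upd [simp]: "bases (e(x := w)) = (bases e)(x := base w)"
  by (auto simp: bases_def)

lemma bases_copy [simp]: "bases (\<lambda>x. copy (r x) (k x)) = r"
  by (auto simp: bases_def)

text \<open>Old relations hold only among base vertices, so leaf arguments must first be replaced by
  their bases. The set \<open>S\<close> collects the variables that may still denote leaves; each
  induction step removes one by renaming it to a bound variable that \<open>Base\<close> forces onto
  the base vertex.\<close>

lemma base_relation:
  fixes L :: "'r set"
  assumes ar: "ar E = 2" "ar M = 1" and M_new: "M \<notin> L" and R: "R \<in> L" and "finite S"
  shows "length xs = ar R \<Longrightarrow> \<exists>\<psi>. formula_of (L \<union> {E, M}) ar \<psi> \<and> free_vars \<psi> \<subseteq> set xs \<and>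
    (\<forall>n (A :: ('a, 'r) rel_struct) e. finite_struct L ar A \<longrightarrow>
      e ` set xs \<subseteq> verts (attach_leaves L E M n A) \<longrightarrow> e ` (set xs - S) \<subseteq> range Inl \<longrightarrow>
      sat (attach_leaves L E M n A) e \<psi> = (map (bases e) xs \<in> interp A R))"
  using \<open>finite S\<close>
proof (induction S arbitrary: xs)
  case empty
  have "map e xs \<in> interp (attach_leaves L E M n A) R \<longleftrightarrow> map (bases e) xs \<in> interp A R"
    if e: "e ` set xs \<subseteq> verts (attach_leaves L E M n A)" "e ` set xs \<subseteq> range Inl"
    for n and A :: "('a, 'r) rel_struct" and e
  proof -
    have eq: "e x = copy (base (e x)) 0" if "x \<in> set xs" for x using e(2) that by auto
    have e_copy: "map e xs = map (\<lambda>x. copy (bases e x) 0) xs"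
      by (rule map_cong[OF refl]) (use eq in \<open>simp add: bases_def\<close>)
    have "\<forall>x\<in>set xs. bases e x \<in> verts A \<and> 0 \<le> n"
      using e(1) by (auto simp: bases_def intro: base_in_verts)
    \<comment> \<open>All positions are zero, so leaf edges contribute nothing even if
      \<open>R = E\<close>.\<close>
    from interp_attach_leaves[OF ar M_new this, of R] show ?thesis
      unfolding e_copy using R by simp
  qed
  then show ?case
    by (intro exI[of _ "Rel R xs"]) (use R empty.prems in auto)
next
  case (insert x S)
  show ?case
  proof (cases "x \<in> set xs")
    case False
    then have "set xs - insert x S = set xs - S" by blast
    then show ?thesis using insert.IH[OF insert.prems] by simp
  next
    case True
    obtain z where z: "z \<notin> insert x (set xs \<union> S)"
      using ex_new_if_finite[of "insert x (set xs \<union> S)"] insert.hyps by auto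
    define ys where "ys = map (\<lambda>y. if y = x then z else y) xs"
    have set_ys: "set ys \<subseteq> insert z (set xs - {x})" by (auto simp: ys_def)
    have "length ys = ar R" using insert.prems by (simp add: ys_def)
    from insert.IH[OF this]
    obtain \<psi> where \<psi>: "formula_of (L \<union> {E, M}) ar \<psi>" "free_vars \<psi> \<subseteq> set ys"
      "\<And>n (A :: ('a, 'r) rel_struct) e. finite_struct L ar A \<Longrightarrow>
        e ` set ys \<subseteq> verts (attach_leaves L E M n A) \<Longrightarrow> e ` (set ys - S) \<subseteq> range Inl \<Longrightarrow>
        sat (attach_leaves L E M n A) e \<psi> = (map (bases e) ys \<in> interp A R)"
      by blast
    have sat: "sat (attach_leaves L E M n A) e (Ex z (Conj (Base E M x z) \<psi>)) =
        (map (bases e) xs \<in> interp A R)"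
      if fin: "finite_struct L ar A" and e: "e ` set xs \<subseteq> verts (attach_leaves L E M n A)"
        "e ` (set xs - insert x S) \<subseteq> range Inl"
      for n and A :: "('a, 'r) rel_struct" and e
    proof -
      let ?B = "attach_leaves L E M n A"
      let ?w = "Inl (base (e x))" let ?e = "e(z := ?w)"
      have ex: "e x \<in> verts ?B" using e True by blast
      then have w: "?w \<in> verts ?B" by (simp add: base_in_verts)
      \<comment> \<open>\<open>Base\<close> leaves exactly one possible witness for
        \<open>z\<close>, so the quantifier amounts to a substitution.\<close>
      have "sat ?B (e(z := w)) (Base E M x z) \<longleftrightarrow> w = ?w" if "w \<in> verts ?B" for w
        using sat_Base[OF ar M_new, of "e(z := w)" x n A z] ex that z by auto
      then have "sat ?B e (Ex z (Conj (Base E M x z) \<psi>)) \<longleftrightarrow> sat ?B ?e \<psi>"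
        using w by auto
      also have "\<dots> \<longleftrightarrow> map (bases ?e) ys \<in> interp A R"
      proof (rule \<psi>(3)[OF fin])
        show "?e ` set ys \<subseteq> verts ?B" using set_ys e(1) w by auto
        show "?e ` (set ys - S) \<subseteq> range Inl"
        proof (rule image_subsetI)
          fix y assume "y \<in> set ys - S"
          then have "y = z \<or> y \<in> set xs - insert x S" using set_ys by blast
          then show "?e y \<in> range Inl" using e(2) by auto
        qed
      qed
      also have "map (bases ?e) ys = map (bases e) xs"
        unfolding ys_def map_map by (rule map_cong[OF refl]) (use z in \<open>auto simp: bases_def\<close>)
      finally show ?thesis .
    qed
    have "free_vars (Ex z (Conj (Base E M x z) \<psi>)) \<subseteq> set xs"
      using \<psi>(2) set_ys True by auto
    moreover have "formula_of (L \<union> {E, M}) ar (Ex z (Conj (Base E M x z) \<psi>))"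
      using \<psi>(1) ar by simp
    ultimately show ?thesis
      by (intro exI[of _ "Ex z (Conj (Base E M x z) \<psi>)"] conjI allI impI sat)
  qed
qed

text \<open>Truth of the translation depends only on bases, and \<open>base\<close> maps the leafy
  vertices onto \<open>verts A\<close>. Quantifiers therefore need no relativisation and are kept as
  they are; only atoms change, with equality becoming equality of bases.\<close>

lemma base_interpretation:
  fixes L :: "'r set"
  assumes ar: "ar E = 2" "ar M = 1" and M_new: "M \<notin> L"
  shows "formula_of L ar \<phi> \<Longrightarrow> \<exists>\<psi>. formula_of (L \<union> {E, M}) ar \<psi> \<and> free_vars \<psi> \<subseteq> free_vars \<phi> \<and>
    (\<forall>n (A :: ('a, 'r) rel_struct) e. finite_struct L ar A \<longrightarrow>
      e ` free_vars \<phi> \<subseteq> verts (attach_leaves L E M n A) \<longrightarrow>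
      sat (attach_leaves L E M n A) e \<psi> = sat A (bases e) \<phi>)"
proof (induction \<phi>)
  case (Eq x y)
  define z where "z = Suc (x + y)"
  have z: "z \<noteq> x" "z \<noteq> y" by (auto simp: z_def)
  have "sat (attach_leaves L E M n A) e (Ex z (Conj (Base E M x z) (Base E M y z))) \<longleftrightarrow>
    base (e x) = base (e y)"
    if e: "e x \<in> verts (attach_leaves L E M n A)" "e y \<in> verts (attach_leaves L E M n A)"
    for n and A :: "('a, 'r) rel_struct" and e
  proof -
    let ?B = "attach_leaves L E M n A"
    have "sat ?B (e(z := w)) (Base E M u z) \<longleftrightarrow> w = Inl (base (e u))"
      if "w \<in> verts ?B" "u = x \<or> u = y" for w u
      using sat_Base[OF ar M_new, of "e(z := w)" u n A z] e that z by auto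
    moreover have "Inl (base (e x)) \<in> verts ?B" using e by (simp add: base_in_verts)
    ultimately show ?thesis by auto
  qed
  then show ?case
    by (intro exI[of _ "Ex z (Conj (Base E M x z) (Base E M y z))"])
      (use ar in \<open>auto simp: bases_def\<close>)
next
  case (Rel R xs)
  then have "R \<in> L" "length xs = ar R" by auto
  from base_relation[OF ar M_new this(1) finite_set this(2), of xs] show ?case
    by auto
next
  case (Neg \<phi>)
  then have "formula_of L ar \<phi>" by simp
  from Neg.IH[OF this] obtain \<psi> where \<psi>: "formula_of (L \<union> {E, M}) ar \<psi>" "free_vars \<psi> \<subseteq> free_vars \<phi>"
    "\<And>n (A :: ('a, 'r) rel_struct) e. finite_struct L ar A \<Longrightarrow>
      e ` free_vars \<phi> \<subseteq> verts (attach_leaves L E M n A) \<Longrightarrow>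
      sat (attach_leaves L E M n A) e \<psi> = sat A (bases e) \<phi>"
    by blast
  show ?case by (rule exI[of _ "Neg \<psi>"]) (use \<psi> in auto)
next
  case (Conj \<phi>1 \<phi>2)
  then have "formula_of L ar \<phi>1" "formula_of L ar \<phi>2" by simp_all
  from Conj.IH(1)[OF this(1)] Conj.IH(2)[OF this(2)] obtain \<psi>1 \<psi>2 where \<psi>: "formula_of (L \<union> {E, M}) ar \<psi>1" "free_vars \<psi>1 \<subseteq> free_vars \<phi>1"
    "\<And>n (A :: ('a, 'r) rel_struct) e. finite_struct L ar A \<Longrightarrow>
      e ` free_vars \<phi>1 \<subseteq> verts (attach_leaves L E M n A) \<Longrightarrow>
      sat (attach_leaves L E M n A) e \<psi>1 = sat A (bases e) \<phi>1"
    "formula_of (L \<union> {E, M}) ar \<psi>2" "free_vars \<psi>2 \<subseteq> free_vars \<phi>2"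
    "\<And>n (A :: ('a, 'r) rel_struct) e. finite_struct L ar A \<Longrightarrow>
      e ` free_vars \<phi>2 \<subseteq> verts (attach_leaves L E M n A) \<Longrightarrow>
      sat (attach_leaves L E M n A) e \<psi>2 = sat A (bases e) \<phi>2"
    by blast
  show ?case by (rule exI[of _ "Conj \<psi>1 \<psi>2"]) (use \<psi> in \<open>auto simp: image_Un\<close>)
next
  case (Ex x \<phi>)
  then have "formula_of L ar \<phi>" by simp
  from Ex.IH[OF this] obtain \<psi> where \<psi>: "formula_of (L \<union> {E, M}) ar \<psi>" "free_vars \<psi> \<subseteq> free_vars \<phi>"
    "\<And>n (A :: ('a, 'r) rel_struct) e. finite_struct L ar A \<Longrightarrow>
      e ` free_vars \<phi> \<subseteq> verts (attach_leaves L E M n A) \<Longrightarrow>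
      sat (attach_leaves L E M n A) e \<psi> = sat A (bases e) \<phi>"
    by blast
  have "sat (attach_leaves L E M n A) e (Ex x \<psi>) = sat A (bases e) (Ex x \<phi>)"
    if fin: "finite_struct L ar A"
      and e: "e ` free_vars (Ex x \<phi>) \<subseteq> verts (attach_leaves L E M n A)"
    for n and A :: "('a, 'r) rel_struct" and e
  proof -
    let ?B = "attach_leaves L E M n A"
    have "sat ?B (e(x := w)) \<psi> = sat A ((bases e)(x := base w)) \<phi>" if "w \<in> verts ?B" for w
    proof -
      have "(e(x := w)) ` free_vars \<phi> \<subseteq> verts ?B" using e that by auto
      then show ?thesis using \<psi>(3)[OF fin, of "e(x := w)" n] by simp
    qed
    moreover have "verts A = base ` verts ?B"
    proof
      show "verts A \<subseteq> base ` verts ?B"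
      proof
        fix v assume "v \<in> verts A"
        then have "Inl v \<in> verts ?B" by simp
        then show "v \<in> base ` verts ?B" by (metis imageI base_simps(1))
      qed
    qed (auto simp: base_in_verts)
    ultimately show ?thesis by simp
  qed
  then show ?case by (intro exI[of _ "Ex x \<psi>"]) (use \<psi>(1,2) in auto)
qed

section \<open>Counting: comparison of the two pairings\<close>

lemma pairing_Neg:
  assumes "finite_struct L ar A"
  shows "pairing p (Neg \<phi>) A = 1 - pairing p \<phi> A"
proof -
  let ?X = "{1..p} \<rightarrow>\<^sub>E verts A" and ?S = "{t \<in> {1..p} \<rightarrow>\<^sub>E verts A. sat A t \<phi>}"
  have fin: "finite ?X" using assms by (auto simp: finite_struct_def intro: finite_PiE)
  have ne: "?X \<noteq> {}" using assms by (auto simp: finite_struct_def PiE_eq_empty_iff)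
  have "{t \<in> ?X. sat A t (Neg \<phi>)} = ?X - ?S" by auto
  moreover have "card (?X - ?S) = card ?X - card ?S"
    by (rule card_Diff_subset) (use fin in auto)
  moreover have "card ?S \<le> card ?X" by (rule card_mono) (use fin in auto)
  moreover have "card ?X > 0" using fin ne by (simp add: card_gt_0_iff)
  ultimately show ?thesis by (simp add: pairing_def of_nat_diff diff_divide_distrib)
qed

lemma pairing_nonneg: "0 \<le> pairing p \<phi> A"
  by (simp add: pairing_def)

lemma pairing_le_1: "finite_struct L ar A \<Longrightarrow> pairing p \<phi> A \<le> 1"
  using pairing_Neg[of L ar A p \<phi>] pairing_nonneg[of p "Neg \<phi>" A] by simp

text \<open>Positions must differ even over different base vertices. All members then share a single
  pattern on \<open>{1..p}\<close>, whatever the bases are.\<close>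

definition distinct_kinds :: "nat \<Rightarrow> nat \<Rightarrow> (nat \<Rightarrow> nat) set" where
  "distinct_kinds p n = {k \<in> {1..p} \<rightarrow>\<^sub>E {1..n}. inj_on k {1..p}}"

text \<open>The exact count is a falling factorial with \<open>p\<close> factors, each at least
  \<open>n - p\<close>.\<close>

lemma card_distinct_kinds_ge:
  assumes "p \<le> n"
  shows "(n - p) ^ p \<le> card (distinct_kinds p n)"
proof -
  have "(n - p) ^ p = (\<Prod>i = 0..<p. n - p)" by simp
  also have "\<dots> \<le> (\<Prod>i = 0..<p. n - i)" by (rule prod_mono) auto
  also have "\<dots> = card (distinct_kinds p n)"
    unfolding distinct_kinds_def
    using card_inj_on_subset_funcset[of "{1..p}" "{1..n}" "{1..p}"] by simp
  finally show ?thesis .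
qed

text \<open>The probability that \<open>p\<close> independent uniform positions in
  \<open>{..n}\<close> are nonzero and pairwise distinct; position \<open>0\<close> accounts for
  \<open>Suc n\<close> in the denominator.\<close>

definition distinct_fraction :: "nat \<Rightarrow> nat \<Rightarrow> real" where
  "distinct_fraction p n = real (card (distinct_kinds p n)) / real (Suc n) ^ p"

lemma distinct_fraction_le_1: "distinct_fraction p n \<le> 1"
proof -
  have "card (distinct_kinds p n) \<le> card ({1..p} \<rightarrow>\<^sub>E {1..n})"
    by (rule card_mono) (auto simp: distinct_kinds_def intro: finite_PiE)
  also have "\<dots> = n ^ p" by (simp add: card_PiE)
  also have "\<dots> \<le> Suc n ^ p" by (rule power_mono) auto
  finally have "real (card (distinct_kinds p n)) \<le> real (Suc n) ^ p"
    by (metis of_nat_mono of_nat_power)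
  then show ?thesis by (simp add: distinct_fraction_def divide_le_eq_1)
qed

text \<open>For fixed \<open>p\<close> the lower bound is the \<open>p\<close>-th power of (n -
  p)/(n + 1) = 1 - (p + 1)/(n + 1).\<close>

lemma distinct_fraction_tendsto: "distinct_fraction p \<longlonglongrightarrow> 1"
proof (rule tendsto_sandwich)
  show "\<forall>\<^sub>F n in sequentially. ((real n - real p) / real (Suc n)) ^ p \<le> distinct_fraction p n"
    using eventually_ge_at_top[of p]
  proof eventually_elim
    case (elim n)
    have "(real n - real p) ^ p = real ((n - p) ^ p)" using elim by (simp add: of_nat_diff)
    also have "\<dots> \<le> real (card (distinct_kinds p n))"
      using card_distinct_kinds_ge[OF elim] of_nat_mono by blast
    finally show ?case
      unfolding distinct_fraction_def power_divide by (rule divide_right_mono) simp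
  qed
  show "\<forall>\<^sub>F n in sequentially. distinct_fraction p n \<le> 1" by (simp add: distinct_fraction_le_1)
  have "(\<lambda>n. 1 - (real p + 1) * inverse (real (Suc n))) \<longlonglongrightarrow> 1 - (real p + 1) * 0"
    by (intro tendsto_intros LIMSEQ_inverse_real_of_nat)
  moreover have "1 - (real p + 1) * inverse (real (Suc n)) = (real n - real p) / real (Suc n)" for n
    by (simp add: field_simps)
  ultimately have "(\<lambda>n. (real n - real p) / real (Suc n)) \<longlonglongrightarrow> 1" by simp
  from tendsto_power[OF this, of p]
  show "(\<lambda>n. ((real n - real p) / real (Suc n)) ^ p) \<longlonglongrightarrow> 1" by simp
qed simp

text \<open>A satisfying tuple of bases and a tuple of distinct leaf positions combine injectively
  into a satisfying tuple of leafy vertices. Dividing by the number of all leafy tuples gives the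
  product of the two probabilities.\<close>

lemma pairing_attach_leaves_ge:
  assumes fin: "finite_struct L ar A" and fv: "free_vars \<psi> \<subseteq> {1..p}"
    and sat: "\<And>r k. r \<in> {1..p} \<rightarrow>\<^sub>E verts A \<Longrightarrow> k \<in> distinct_kinds p n \<Longrightarrow> sat A r \<phi> \<Longrightarrow>
      sat (attach_leaves L E M n A) (\<lambda>x. copy (r x) (k x)) \<psi>"
  shows "distinct_fraction p n * pairing p \<phi> A \<le> pairing p \<psi> (attach_leaves L E M n A)"
proof -
  let ?B = "attach_leaves L E M n A"
  let ?S = "{r \<in> {1..p} \<rightarrow>\<^sub>E verts A. sat A r \<phi>}" and ?T = "{t \<in> {1..p} \<rightarrow>\<^sub>E verts ?B. sat ?B t \<psi>}"
  let ?h = "\<lambda>(r, k). \<lambda>x\<in>{1..p}. copy (r x) (k x)"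
  have finA: "finite (verts A)" using fin by (simp add: finite_struct_def)
  then have finB: "finite (verts ?B)" by (simp add: verts_attach_leaves)
  have inj: "inj_on ?h (?S \<times> distinct_kinds p n)"
  proof (rule inj_onI, clarify)
    fix r k r' k' assume r: "r \<in> {1..p} \<rightarrow>\<^sub>E verts A" "r' \<in> {1..p} \<rightarrow>\<^sub>E verts A"
      and k: "k \<in> distinct_kinds p n" "k' \<in> distinct_kinds p n"
      and eq: "(\<lambda>x\<in>{1..p}. copy (r x) (k x)) = (\<lambda>x\<in>{1..p}. copy (r' x) (k' x))"
    have "r x = r' x \<and> k x = k' x" if "x \<in> {1..p}" for x
      using fun_cong[OF eq, of x] that by simp
    moreover have "k \<in> {1..p} \<rightarrow>\<^sub>E {1..n}" "k' \<in> {1..p} \<rightarrow>\<^sub>E {1..n}"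
      using k by (simp_all add: distinct_kinds_def)
    ultimately show "r = r' \<and> k = k'" using r by (blast intro: PiE_ext)
  qed
  have sub: "?h ` (?S \<times> distinct_kinds p n) \<subseteq> ?T"
  proof (rule image_subsetI, clarify)
    fix r k assume r: "r \<in> {1..p} \<rightarrow>\<^sub>E verts A" and k: "k \<in> distinct_kinds p n" and s: "sat A r \<phi>"
    let ?t = "\<lambda>x\<in>{1..p}. copy (r x) (k x)"
    \<comment> \<open>Tuples must be undefined outside \<open>{1..p}\<close>; the restriction is
      invisible to a formula with free variables in that range.\<close>
    have "sat ?B ?t \<psi> = sat ?B (\<lambda>x. copy (r x) (k x)) \<psi>"
      by (rule sat_cong) (use fv in auto)
    moreover have "?t \<in> {1..p} \<rightarrow>\<^sub>E verts ?B"
      using r k by (fastforce simp: distinct_kinds_def)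
    ultimately show "?t \<in> {1..p} \<rightarrow>\<^sub>E verts ?B \<and> sat ?B ?t \<psi>" using sat[OF r k s] by simp
  qed
  have "finite ({1..p} \<rightarrow>\<^sub>E verts ?B)" using finB by (intro finite_PiE) auto
  then have finT: "finite ?T" by simp
  have "card ?S * card (distinct_kinds p n) = card (?h ` (?S \<times> distinct_kinds p n))"
    by (simp only: card_image[OF inj] card_cartesian_product)
  also have "\<dots> \<le> card ?T" by (rule card_mono[OF finT sub])
  finally have le: "real (card ?S) * real (card (distinct_kinds p n)) \<le> real (card ?T)"
    by (simp only: of_nat_mult[symmetric] of_nat_le_iff)
  \<comment> \<open>Every base vertex accounts for \<open>Suc n\<close> leafy vertices, itself
    included, which produces the denominator of \<open>distinct_fraction\<close>.\<close>
  have "inj_on (\<lambda>(v, j). copy v j) (verts A \<times> {..n})" by (auto simp: inj_on_def)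
  then have "card (verts ?B) = card (verts A) * Suc n"
    unfolding verts_attach_leaves by (simp add: card_image card_cartesian_product)
  then have "card ({1..p} \<rightarrow>\<^sub>E verts ?B) = card ({1..p} \<rightarrow>\<^sub>E verts A) * Suc n ^ p"
    by (simp add: card_PiE power_mult_distrib del: mult_Suc_right)
  then have "pairing p \<psi> ?B = real (card ?T) / (real (card ({1..p} \<rightarrow>\<^sub>E verts A)) * real (Suc n) ^ p)"
    by (simp only: pairing_def of_nat_mult of_nat_power)
  moreover have "distinct_fraction p n * pairing p \<phi> A = real (card ?S) * real (card (distinct_kinds p n)) /
      (real (card ({1..p} \<rightarrow>\<^sub>E verts A)) * real (Suc n) ^ p)"
    by (simp only: pairing_def distinct_fraction_def times_divide_times_eq mult.commute)
  ultimately show ?thesis using le by (simp add: divide_right_mono)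
qed

text \<open>The one-sided bound is applied to the formula and to its negation. With q the distinct
  fraction, a the pairing over the base structure and b the leafy one, this gives q a \<le> b and q
  (1 - a) \<le> 1 - b, so b - a lies between -(1 - q) a and (1 - q)(1 - a).\<close>

lemma pairing_attach_leaves_close:
  assumes fin: "finite_struct L ar A" and ar: "ar E = 2" "ar M = 1"
    and fv: "free_vars \<psi> \<subseteq> {1..p}"
    and sat: "\<And>r k. r \<in> {1..p} \<rightarrow>\<^sub>E verts A \<Longrightarrow> k \<in> distinct_kinds p n \<Longrightarrow>
      sat (attach_leaves L E M n A) (\<lambda>x. copy (r x) (k x)) \<psi> = sat A r \<phi>"
  shows "\<bar>pairing p \<psi> (attach_leaves L E M n A) - pairing p \<phi> A\<bar> \<le> 1 - distinct_fraction p n"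
proof -
  let ?B = "attach_leaves L E M n A" and ?q = "distinct_fraction p n"
  have "?q * pairing p \<phi> A \<le> pairing p \<psi> ?B"
    by (rule pairing_attach_leaves_ge[OF fin fv]) (simp add: sat)
  moreover have "?q * pairing p (Neg \<phi>) A \<le> pairing p (Neg \<psi>) ?B"
    by (rule pairing_attach_leaves_ge[OF fin]) (use fv in \<open>simp_all add: sat\<close>)
  then have "?q * (1 - pairing p \<phi> A) \<le> 1 - pairing p \<psi> ?B"
    by (simp only: pairing_Neg[OF fin] pairing_Neg[OF finite_struct_attach_leaves[OF fin ar]])
  moreover have "(1 - ?q) * pairing p \<phi> A \<le> 1 - ?q" "(1 - ?q) * (1 - pairing p \<phi> A) \<le> 1 - ?q"
    using distinct_fraction_le_1[of p n] pairing_nonneg[of p \<phi> A] pairing_le_1[OF fin, of p \<phi>]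
    by (auto intro!: mult_left_le)
  ultimately show ?thesis by (simp add: algebra_simps abs_le_iff)
qed

text \<open>The two sequences eventually differ by at most a null sequence. Agreement is demanded
  only from \<open>N\<close> on because leaf elimination is valid only for large
  \<open>n\<close>.\<close>

lemma convergent_pairing_attach_leaves_iff:
  assumes fin: "\<And>n. finite_struct L ar (A n)" and ar: "ar E = 2" "ar M = 1"
    and fv: "free_vars \<psi> \<subseteq> {1..p}"
    and sat: "\<And>n r k. n \<ge> N \<Longrightarrow> r \<in> {1..p} \<rightarrow>\<^sub>E verts (A n) \<Longrightarrow> k \<in> distinct_kinds p n \<Longrightarrow>
      sat (attach_leaves L E M n (A n)) (\<lambda>x. copy (r x) (k x)) \<psi> = sat (A n) r \<phi>"
  shows "convergent (\<lambda>n. pairing p \<psi> (attach_leaves L E M n (A n))) \<longleftrightarrow>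
    convergent (\<lambda>n. pairing p \<phi> (A n))"
proof -
  let ?b = "\<lambda>n. pairing p \<psi> (attach_leaves L E M n (A n))" and ?a = "\<lambda>n. pairing p \<phi> (A n)"
  have lim: "(\<lambda>n. ?b n - ?a n) \<longlonglongrightarrow> 0"
  proof (rule tendsto_0_le)
    show "(\<lambda>n. 1 - distinct_fraction p n) \<longlonglongrightarrow> 0"
      using tendsto_diff[OF tendsto_const distinct_fraction_tendsto, of 1 p] by simp
    show "\<forall>\<^sub>F n in sequentially. norm (?b n - ?a n) \<le> norm (1 - distinct_fraction p n) * 1"
      using eventually_ge_at_top[of N]
    proof eventually_elim
      case (elim n)
      have "\<bar>?b n - ?a n\<bar> \<le> 1 - distinct_fraction p n"
        by (rule pairing_attach_leaves_close[OF fin ar fv]) (rule sat[OF elim])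
      then show ?case by simp
    qed
  qed
  show ?thesis
  proof
    assume "convergent ?b"
    then obtain l where "?b \<longlonglongrightarrow> l" by (auto simp: convergent_def)
    from tendsto_diff[OF this lim] show "convergent ?a" by (auto simp: convergent_def)
  next
    assume "convergent ?a"
    then obtain l where "?a \<longlonglongrightarrow> l" by (auto simp: convergent_def)
    from tendsto_add[OF this lim] show "convergent ?b" by (auto simp: convergent_def)
  qed
qed

section \<open>The two directions of the equivalence\<close>

theorem proposition7p1:
  fixes L :: "'r set" and ar :: "'r \<Rightarrow> nat" and E M :: 'r
    and p :: nat and A :: "nat \<Rightarrow> ('a, 'r) rel_struct"
  assumes "\<forall>R\<in>L. 0 < ar R"
    and "ar E = 2" and "ar M = 1" and "M \<notin> L"
    and "\<And>n. finite_struct L ar (A n)"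
  shows "FO_convergent L ar p A \<longleftrightarrow>
         FO_convergent (L \<union> {E, M}) ar p (\<lambda>n. attach_leaves L E M n (A n))"
proof
  note ar = assms(2,3) and M_new = assms(4) and fin = assms(5)
  have ne: "verts (A n) \<noteq> {}" for n using fin by (simp add: finite_struct_def)
  show "FO_convergent (L \<union> {E, M}) ar p (\<lambda>n. attach_leaves L E M n (A n))"
    if conv: "FO_convergent L ar p A"
    unfolding FO_convergent_def
  proof
    fix \<psi> assume "\<psi> \<in> FO (L \<union> {E, M}) ar p"
    then have \<psi>: "formula_of (L \<union> {E, M}) ar \<psi>" and fv: "free_vars \<psi> \<subseteq> {1..p}"
      by (auto simp: FO_def)
    \<comment> \<open>Since variables are numbered from 1, \<open>id\<close> gives the variables in
      \<open>{1..p}\<close> nonzero, pairwise distinct positions, so it represents the pattern of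
      every member of \<open>distinct_kinds p n\<close>.\<close>
    from leaf_elimination[OF ar M_new \<psi>, of id]
    obtain \<phi> N where \<phi>: "formula_of L ar \<phi>" "free_vars \<phi> \<subseteq> free_vars \<psi>"
      "\<And>n (A :: ('a, 'r) rel_struct). n \<ge> N \<Longrightarrow> verts A \<noteq> {} \<Longrightarrow> expressed_by L E M n A id \<psi> \<phi>"
      by metis
    have "convergent (\<lambda>n. pairing p \<psi> (attach_leaves L E M n (A n))) \<longleftrightarrow>
      convergent (\<lambda>n. pairing p \<phi> (A n))"
    proof (rule convergent_pairing_attach_leaves_iff[OF fin ar fv])
      fix n r k assume n: "n \<ge> N" and r: "r \<in> {1..p} \<rightarrow>\<^sub>E verts (A n)" and k: "k \<in> distinct_kinds p n"
      have kr: "k x \<in> {1..n}" if "x \<in> {1..p}" for x using k that by (auto simp: distinct_kinds_def)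
      have inj: "inj_on k {1..p}" using k by (simp add: distinct_kinds_def)
      have pat: "same_pattern {1..p} id k"
        unfolding same_pattern_def
      proof (intro conjI ballI)
        fix x y assume "x \<in> {1..p}" "y \<in> {1..p}"
        then show "id x = id y \<longleftrightarrow> k x = k y"
          using inj_on_eq_iff[OF inj] by simp
      qed (use kr in force)
      show "sat (attach_leaves L E M n (A n)) (\<lambda>x. copy (r x) (k x)) \<psi> = sat (A n) r \<phi>"
      proof (rule expressed_byD[OF \<phi>(3)[OF n ne]])
        show "r ` free_vars \<psi> \<subseteq> verts (A n)" using r fv by auto
        show "k ` free_vars \<psi> \<subseteq> {..n}" using kr fv by fastforce
        show "same_pattern (free_vars \<psi>) id k" using same_pattern_mono[OF pat fv] .
      qed
    qed
    moreover have "\<phi> \<in> FO L ar p" using \<phi> fv by (auto simp: FO_def)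
    ultimately show "convergent (\<lambda>n. pairing p \<psi> (attach_leaves L E M n (A n)))"
      using conv by (auto simp: FO_convergent_def)
  qed
  show "FO_convergent L ar p A"
    if conv: "FO_convergent (L \<union> {E, M}) ar p (\<lambda>n. attach_leaves L E M n (A n))"
    unfolding FO_convergent_def
  proof
    fix \<phi> assume "\<phi> \<in> FO L ar p"
    then have \<phi>: "formula_of L ar \<phi>" and fv: "free_vars \<phi> \<subseteq> {1..p}"
      by (auto simp: FO_def)
    from base_interpretation[OF ar M_new \<phi>]
    obtain \<psi> where \<psi>: "formula_of (L \<union> {E, M}) ar \<psi>" "free_vars \<psi> \<subseteq> free_vars \<phi>"
      "\<And>n (A :: ('a, 'r) rel_struct) e. finite_struct L ar A \<Longrightarrow>
        e ` free_vars \<phi> \<subseteq> verts (attach_leaves L E M n A) \<Longrightarrow>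
        sat (attach_leaves L E M n A) e \<psi> = sat A (bases e) \<phi>"
      by blast
    have fv': "free_vars \<psi> \<subseteq> {1..p}" using \<psi>(2) fv by blast
    have "convergent (\<lambda>n. pairing p \<psi> (attach_leaves L E M n (A n))) \<longleftrightarrow>
      convergent (\<lambda>n. pairing p \<phi> (A n))"
    proof (rule convergent_pairing_attach_leaves_iff[OF fin ar fv'])
      fix n r k assume r: "r \<in> {1..p} \<rightarrow>\<^sub>E verts (A n)" and k: "k \<in> distinct_kinds p n"
      let ?e = "\<lambda>x. copy (r x) (k x)"
      have "?e ` free_vars \<phi> \<subseteq> verts (attach_leaves L E M n (A n))"
      proof (rule image_subsetI)
        fix x assume "x \<in> free_vars \<phi>"
        then have "x \<in> {1..p}" using fv by blast
        then have "r x \<in> verts (A n)" "k x \<in> {1..n}" using r k by (auto simp: distinct_kinds_def)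
        then show "?e x \<in> verts (attach_leaves L E M n (A n))" by simp
      qed
      \<comment> \<open>The bases of the combined assignment are \<open>r\<close> itself, so the
        translation evaluates \<open>\<phi>\<close> at \<open>r\<close>.\<close>
      from \<psi>(3)[OF fin this]
      show "sat (attach_leaves L E M n (A n)) ?e \<psi> = sat (A n) r \<phi>" by simp
    qed
    moreover have "\<psi> \<in> FO (L \<union> {E, M}) ar p" using \<psi>(1) fv' by (auto simp: FO_def)
    ultimately show "convergent (\<lambda>n. pairing p \<phi> (A n))"
      using conv by (auto simp: FO_convergent_def)
  qed
qed

end
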